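(* Let $\mathbb F$ be a field of characteristic zero, and let $A(\lambda), B(\lambda)\in M_{n,n}(\mathbb F[\lambda])$ be nonsingular matrices that are equivalent, with common Smith normal form $S(\lambda)=\operatorname{diag}(s_1(\lambda),\dots,s_{n-1}(\lambda),s_n(\lambda))$. Suppose that $s_n(\lambda)=(\lambda-\alpha_1)^{k_1}(\lambda-\alpha_2)^{k_2}\cdots(\lambda-\alpha_r)^{k_r}$, where $\alpha_1,\dots,\alpha_r\in\mathbb F$ are pairwise distinct and the $k_i$ are positive integers. Let $$D(\lambda)=\Bigl(\bigl(s_1(\lambda)s_2(\lambda)\cdots s_{n-1}(\lambda)\bigr)^{-1}B^*(\lambda)\Bigr)\otimes A^T(\lambda)\in M_{n^2,n^2}(\mathbb F[\lambda]).$$ Then $A(\lambda)$ and $B(\lambda)$ are semi-scalar equivalent if and only if $\operatorname{rank} M[D,s_n]<n^2$ and the homogeneous system of linear equations $M[D,s_n]\,x=\bar 0$ has a solution $x=[v_1,v_2,\dots,v_{n^2}]^T$ over $\mathbb F$ such that the matrix $$V=\begin{bmatrix} v_1 & v_2 & \cdots & v_n\\ v_{n+1} & v_{n+2} & \cdots & v_{2n}\\ \vdots & \vdots & & \vdots\\ v_{n^2-n+1} & v_{n^2-n+2} & \cdots & v_{n^2}\end{bmatrix}$$ is nonsingular. Moreover, if $x$ is a solution of $M[D,s_n]x=\bar 0$ over $\mathbb F$ whose associated matrix $V$ satisfies $\det V\neq 0$, then $VA(\lambda)=B(\lambda)Q(\lambda)$ for some $Q(\lambda)\in GL(n,\mathbb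 F[\lambda])$.
   Context: $M_{m,n}(R)$ is the set of $m\times n$ matrices over a ring $R$ and $GL(n,R)$ the group of invertible $n\times n$ matrices over $R$. A matrix $A(\lambda)\in M_{n,n}(\mathbb F[\lambda])$ is nonsingular if $\det A(\lambda)\ne 0$ in $\mathbb F[\lambda]$. Matrices $A(\lambda),B(\lambda)\in M_{n,n}(\mathbb F[\lambda])$ are equivalent if $A(\lambda)=P(\lambda)B(\lambda)Q(\lambda)$ for some $P(\lambda),Q(\lambda)\in GL(n,\mathbb F[\lambda])$. They are semi-scalar equivalent if $A(\lambda)=PB(\lambda)Q(\lambda)$ for some $P\in GL(n,\mathbb F)$ (a constant matrix) and $Q(\lambda)\in GL(n,\mathbb F[\lambda])$. The Smith normal form of a nonsingular $A(\lambda)$ is the diagonal matrix $\operatorname{diag}(s_1(\lambda),\dots,s_n(\lambda))$ equivalent to $A(\lambda)$ with all $s_i(\lambda)$ monic and $s_1(\lambda)\mid s_2(\lambda)\mid\cdots\mid s_n(\lambda)$. $B^*(\lambda)$ denotes the classical adjoint (adjugate) of $B(\lambda)$, and $A^T(\lambda)$ the transpose of $A(\lambda)$. The adjugate $B^*(\lambda)$ is entrywise divisible by $s_1(\lambda)\cdots s_{n-1}(\lambda)$, so $D(\lambda)$ is a polynomial matrix. The Kronecker product of $X=[x_{ij}]$ and $Y$ is the block matrix $X\otimes Y=[x_{ij}Y]$. For $G(\lambda)\in M_{m,n}(\mathbb F[\lambda])$, $G^{(k)}(\lambda)$ denotes its entrywise $k$-th formal derivative. For a monic polynomial $b(\lambda)=(\lambda-\beta_1)^{k_1}\cdots(\lambda-\beta_r)^{k_r}$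 with pairwise distinct $\beta_j\in\mathbb F$ and degree $k=k_1+\cdots+k_r$, define $$M[G,b]=\begin{bmatrix}N_1\\ \vdots\\ N_r\end{bmatrix}\in M_{mk,n}(\mathbb F),\qquad N_j=\begin{bmatrix}G(\beta_j)\\ G^{(1)}(\beta_j)\\ \vdots\\ G^{(k_j-1)}(\beta_j)\end{bmatrix}\in M_{mk_j,n}(\mathbb F).$$ *)

theory Defs
  imports "Jordan_Normal_Form.DL_Rank" "HOL-Computational_Algebra.Polynomial"
begin

definition GL_mat :: "nat \<Rightarrow> 'a::comm_ring_1 mat set" where
  "GL_mat n = {P \<in> carrier_mat n n. invertible_mat P}"

abbreviation const_poly_mat :: "'a::zero mat \<Rightarrow> 'a poly mat" where
  "const_poly_mat \<equiv> map_mat (\<lambda>c. [:c:])"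

definition equivalent_mat :: "nat \<Rightarrow> 'a::field poly mat \<Rightarrow> 'a poly mat \<Rightarrow> bool" where
  "equivalent_mat n A B \<longleftrightarrow> (\<exists>P \<in> GL_mat n. \<exists>Q \<in> GL_mat n. A = P * B * Q)"

definition semi_scalar_equivalent_mat ::
  "nat \<Rightarrow> 'a::field poly mat \<Rightarrow> 'a poly mat \<Rightarrow> bool" where
  "semi_scalar_equivalent_mat n A B \<longleftrightarrow>
     (\<exists>P \<in> GL_mat n. \<exists>Q \<in> GL_mat n. A = const_poly_mat P * B * Q)"

text \<open>The sequence \<open>s\<close> is indexed from 1, so that \<open>s i\<close> is $s_i$; only \<open>s 1, \<dots>, s n\<close> matter.\<close>

definition smith_normal_form :: "nat \<Rightarrow> 'a::field poly mat \<Rightarrow> (nat \<Rightarrow> 'a poly) \<Rightarrow> bool" where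
  "smith_normal_form n A s \<longleftrightarrow>
     equivalent_mat n A (mat_diag n (\<lambda>i. s (Suc i))) \<and>
     (\<forall>i \<in> {1..n}. lead_coeff (s i) = 1) \<and>
     (\<forall>i \<in> {1..<n}. s i dvd s (Suc i))"

definition kronecker_mat :: "'a::times mat \<Rightarrow> 'a mat \<Rightarrow> 'a mat" where
  "kronecker_mat X Y =
     mat (dim_row X * dim_row Y) (dim_col X * dim_col Y)
       (\<lambda>(i, j). X $$ (i div dim_row Y, j div dim_col Y) * Y $$ (i mod dim_row Y, j mod dim_col Y))"

definition stack_mats :: "nat \<Rightarrow> 'a::zero mat list \<Rightarrow> 'a mat" where
  "stack_mats nc Ms = foldr (@\<^sub>r) Ms (0\<^sub>m 0 nc)"

definition deriv_mat :: "nat \<Rightarrow> 'a::field poly mat \<Rightarrow> 'a poly mat" where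
  "deriv_mat l G = map_mat (pderiv ^^ l) G"

definition N_mat :: "'a::field poly mat \<Rightarrow> 'a \<Rightarrow> nat \<Rightarrow> 'a mat" where
  "N_mat G \<beta> k =
     stack_mats (dim_col G) (map (\<lambda>l. map_mat (\<lambda>p. poly p \<beta>) (deriv_mat l G)) [0..<k])"

text \<open>The matrix $M[G,b]$ for $b = \prod_{j=1}^r (\lambda - \beta_j)^{k_j}$. It depends on the order
  in which the roots of \<open>b\<close> are listed, so the argument is the factorisation and not \<open>b\<close> itself.\<close>

definition M_mat :: "'a::field poly mat \<Rightarrow> nat \<Rightarrow> (nat \<Rightarrow> 'a) \<Rightarrow> (nat \<Rightarrow> nat) \<Rightarrow> 'a mat" where
  "M_mat G r \<beta> k = stack_mats (dim_col G) (map (\<lambda>j. N_mat G (\<beta> j) (k j)) [1..<Suc r])"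

text \<open>The parameter of \<open>vec_space.rank\<close> is the length of the columns.\<close>

definition rank_mat :: "'a::field mat \<Rightarrow> nat" where
  "rank_mat M = vec_space.rank (dim_row M) M"

text \<open>The polynomial matrix $D$ of the pair \<open>A\<close>, \<open>B\<close>. When \<open>s\<close> is the Smith normal form of the
  nonsingular matrix \<open>B\<close>, the entrywise division is exact.\<close>

definition D_mat ::
  "nat \<Rightarrow> (nat \<Rightarrow> 'a::field poly) \<Rightarrow> 'a poly mat \<Rightarrow> 'a poly mat \<Rightarrow> 'a poly mat" where
  "D_mat n s A B =
     kronecker_mat (map_mat (\<lambda>p. p div (\<Prod>i = 1..n - 1. s i)) (adj_mat B)) (transpose_mat A)"

definition mat_of_rowwise_vec :: "nat \<Rightarrow> 'a vec \<Rightarrow> 'a mat" where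
  "mat_of_rowwise_vec n x = mat n n (\<lambda>(i, j). x $ (i * n + j))"

end

theory Submission
  imports Defs "Subresultants.More_Homomorphisms"
begin

text \<open>
  A constant change of rows that makes \<open>A\<close> semi-scalar equivalent to \<open>B\<close> is an invertible constant
  matrix \<open>V\<close> for which \<open>V A\<close> is a right multiple \<open>B Q\<close> of \<open>B\<close> with \<open>Q\<close> invertible. The proof turns
  the existence of the quotient \<open>Q\<close> into linear equations for the entries of \<open>V\<close>.

  Let \<open>C\<close> be the adjugate of \<open>B\<close> divided by \<open>s\<^sub>1 \<dots> s\<^sub>n\<^sub>-\<^sub>1\<close>. Since \<open>det B\<close> is a unit times
  \<open>s\<^sub>1 \<dots> s\<^sub>n\<close>, both \<open>B C\<close> and \<open>C B\<close> are a unit times \<open>s\<^sub>n\<close> times the identity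
  (\<open>reduced_adj_mat_inverts\<close>). So \<open>C / s\<^sub>n\<close> is the inverse of \<open>B\<close> up to a unit, and \<open>X = B Q\<close> has a
  polynomial solution \<open>Q\<close> if and only if \<open>s\<^sub>n\<close> divides every entry of \<open>C X\<close>
  (\<open>reduced_adj_mat_mult_dvd_iff\<close>).

  For \<open>X = V A\<close> the entries of \<open>C V A\<close>, read row by row, form the vector \<open>D x\<close>, where \<open>x\<close> lists the
  entries of \<open>V\<close> row by row (\<open>kronecker_mat_mult_vec\<close>). In characteristic zero, \<open>s\<^sub>n\<close> divides a
  polynomial exactly when the derivatives of order below \<open>k\<^sub>j\<close> vanish at \<open>\<alpha>\<^sub>j\<close> for every \<open>j\<close>. As \<open>x\<close>
  is constant, differentiating and evaluating \<open>D x\<close> only affects \<open>D\<close>, so these conditions are the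
  system \<open>M x = 0\<close> (\<open>M_mat_mult_vec_eq_0_iff\<close>).

  If \<open>det V\<close> is nonzero, \<open>Q\<close> is automatically invertible: \<open>A\<close> and \<open>B\<close> have the same determinant up
  to a unit, hence \<open>det Q\<close> is a unit (\<open>quotient_in_GL_mat\<close>). The rank of \<open>M\<close> is below
  \<open>n\<^sup>2\<close> because a nonsingular \<open>V\<close> gives a nonzero kernel vector (\<open>nontrivial_kernel_rank_less\<close>).
\<close>

section \<open>Invertible matrices over commutative rings\<close>

lemma GL_mat_obtain_inverse:
  assumes "P \<in> GL_mat n"
  obtains P' where "P' \<in> GL_mat n" "P * P' = 1\<^sub>m n" "P' * P = 1\<^sub>m n"
proof -
  from assms obtain P' where P: "P \<in> carrier_mat n n"
    and PP': "P * P' = 1\<^sub>m n" and P'P: "P' * P = 1\<^sub>m (dim_row P')"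
    unfolding GL_mat_def invertible_mat_def inverts_mat_def by auto
  have "dim_col P' = n" using arg_cong[OF PP', of dim_col] by simp
  moreover have "dim_row P' = n" using arg_cong[OF P'P, of dim_col] P by simp
  ultimately have P': "P' \<in> carrier_mat n n" by auto
  moreover have "P' \<in> GL_mat n"
    using P P' PP' P'P unfolding GL_mat_def invertible_mat_def inverts_mat_def by auto
  ultimately show thesis using that PP' P'P by simp
qed

text \<open>
  The adjugate is an inverse up to the factor \<open>det Q\<close>, so a reciprocal of \<open>det Q\<close> in the ring is all
  that a two-sided inverse requires.
\<close>

lemma GL_mat_iff_det_unit:
  fixes Q :: "'a::comm_ring_1 mat"
  assumes Q: "Q \<in> carrier_mat n n"
  shows "Q \<in> GL_mat n \<longleftrightarrow> det Q dvd 1"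
proof
  assume "Q \<in> GL_mat n"
  then obtain Q' where "Q' \<in> GL_mat n" and QQ': "Q * Q' = 1\<^sub>m n"
    by (rule GL_mat_obtain_inverse)
  then have Q': "Q' \<in> carrier_mat n n" by (simp add: GL_mat_def)
  have "det Q * det Q' = 1" using det_mult[OF Q Q'] QQ' by simp
  then show "det Q dvd 1" by (metis dvdI)
next
  assume "det Q dvd 1"
  then obtain u where u: "1 = det Q * u" by (rule dvdE)
  let ?Q' = "u \<cdot>\<^sub>m adj_mat Q"
  note adj = adj_mat[OF Q]
  have "Q * ?Q' = u \<cdot>\<^sub>m (det Q \<cdot>\<^sub>m 1\<^sub>m n)"
    using mult_smult_distrib[OF Q adj(1)] adj by simp
  moreover have "?Q' * Q = u \<cdot>\<^sub>m (det Q \<cdot>\<^sub>m 1\<^sub>m n)"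
    using mult_smult_assoc_mat[OF adj(1) Q] adj by simp
  moreover have "u \<cdot>\<^sub>m (det Q \<cdot>\<^sub>m 1\<^sub>m n) = 1\<^sub>m n"
    using u by (intro eq_matI) (auto simp: mult.commute)
  ultimately show "Q \<in> GL_mat n"
    using Q adj(1) unfolding GL_mat_def invertible_mat_def inverts_mat_def
    by (auto intro!: exI[of _ ?Q'])
qed

section \<open>Divisibility and vanishing derivatives\<close>

text \<open>
  A root of \<open>p\<close> has in \<open>pderiv p\<close> a multiplicity that is lower by exactly one; this is where
  characteristic zero enters. Hence one more power of the linear factor costs one more derivative.
\<close>

lemma linear_power_dvd_iff_higher_pderiv:
  fixes p :: "'a::field_char_0 poly"
  shows "[:- a, 1:] ^ k dvd p \<longleftrightarrow> (\<forall>l<k. poly ((pderiv ^^ l) p) a = 0)"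
proof (induction k arbitrary: p)
  case 0
  show ?case by simp
next
  case (Suc k)
  have step: "[:- a, 1:] ^ Suc k dvd p \<longleftrightarrow> poly p a = 0 \<and> [:- a, 1:] ^ k dvd pderiv p"
  proof (cases "p = 0")
    case False
    show ?thesis
    proof (cases "poly p a = 0")
      case True
      \<comment> \<open>otherwise \<open>p\<close> would be a nonzero constant with a root\<close>
      have "pderiv p \<noteq> 0"
        using pderiv_iszero[of p] True False by auto
      then show ?thesis
        using order_pderiv[OF False True] True False by (simp only: order_divides) auto
    next
      case nz: False
      then have "order a p = 0" by (rule order_0I)
      then show ?thesis using nz False by (simp only: order_divides) auto
    qed
  qed simp
  have "(\<forall>l<Suc k. poly ((pderiv ^^ l) p) a = 0) \<longleftrightarrow>
      poly p a = 0 \<and> (\<forall>l<k. poly ((pderiv ^^ l) (pderiv p)) a = 0)"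
    by (auto simp: less_Suc_eq_0_disj funpow_swap1)
  then show ?case using step Suc.IH[of "pderiv p"] by simp
qed

text \<open>
  The other linear factors do not vanish at \<open>\<alpha> i\<close>, so splitting them off leaves the order of the root
  \<open>\<alpha> i\<close> unchanged. Counting orders replaces the usual coprimality argument and works over every
  integral domain.
\<close>

lemma prod_linear_power_dvd_iff:
  fixes p :: "'a::idom poly"
  assumes "finite I" "inj_on \<alpha> I"
  shows "(\<Prod>i\<in>I. [:- \<alpha> i, 1:] ^ k i) dvd p \<longleftrightarrow> (\<forall>i\<in>I. [:- \<alpha> i, 1:] ^ k i dvd p)"
  using assms
proof (induction I)
  case empty
  show ?case by simp
next
  case (insert i I)
  let ?b = "\<Prod>i\<in>I. [:- \<alpha> i, 1:] ^ k i"
  have "[:- \<alpha> i, 1:] ^ k i * ?b dvd p" if i: "[:- \<alpha> i, 1:] ^ k i dvd p" and b: "?b dvd p"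
  proof (cases "p = 0")
    case False
    from b obtain q where q: "p = ?b * q" by (rule dvdE)
    have "poly ?b (\<alpha> i) \<noteq> 0"
      using insert by (auto simp: poly_prod poly_power)
    then have "order (\<alpha> i) ?b = 0" by (rule order_0I)
    then have "order (\<alpha> i) p = order (\<alpha> i) q"
      using order_mult[of ?b q "\<alpha> i"] q False by simp
    then have "[:- \<alpha> i, 1:] ^ k i dvd q"
      using i False unfolding order_divides by simp
    then have "[:- \<alpha> i, 1:] ^ k i * ?b dvd q * ?b" by (intro mult_dvd_mono dvd_refl)
    then show ?thesis unfolding q by (simp only: mult.commute)
  qed simp
  then show ?case using insert by (auto dest: dvd_mult_left dvd_mult_right)
qed

section \<open>The kernel of the stacked derivative matrix\<close>

lemma stack_mats_carrier:
  assumes "\<And>N. N \<in> set Ns \<Longrightarrow> dim_col N = nc"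
  shows "stack_mats nc Ns \<in> carrier_mat (\<Sum>N\<leftarrow>Ns. dim_row N) nc"
  using assms
proof (induction Ns)
  case (Cons N Ns)
  have "N \<in> carrier_mat (dim_row N) nc" using Cons.prems[of N] by auto
  moreover have "stack_mats nc Ns \<in> carrier_mat (\<Sum>N\<leftarrow>Ns. dim_row N) nc"
    using Cons by auto
  ultimately have "N @\<^sub>r stack_mats nc Ns \<in> carrier_mat (dim_row N + (\<Sum>N\<leftarrow>Ns. dim_row N)) nc"
    by (rule carrier_append_rows)
  then show ?case by (simp only: stack_mats_def foldr.simps comp_apply list.map sum_list.Cons)
qed (simp add: stack_mats_def)

lemma dim_col_stack_mats:
  assumes "\<And>N. N \<in> set Ns \<Longrightarrow> dim_col N = nc"
  shows "dim_col (stack_mats nc Ns) = nc"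
  using stack_mats_carrier[OF assms] by (rule carrier_matD)

lemma dim_col_N_mat: "dim_col (N_mat G \<beta> k) = dim_col G"
  unfolding N_mat_def by (rule dim_col_stack_mats) (auto simp: deriv_mat_def)

lemma dim_col_M_mat: "dim_col (M_mat G r \<beta> k) = dim_col G"
  unfolding M_mat_def by (rule dim_col_stack_mats) (auto simp: dim_col_N_mat)

lemma stack_mats_mult_vec_eq_0_iff:
  fixes Ns :: "'a::comm_ring_1 mat list"
  assumes x: "x \<in> carrier_vec nc" and "\<And>N. N \<in> set Ns \<Longrightarrow> dim_col N = nc"
  shows "stack_mats nc Ns *\<^sub>v x = 0\<^sub>v (dim_row (stack_mats nc Ns)) \<longleftrightarrow>
    (\<forall>N\<in>set Ns. N *\<^sub>v x = 0\<^sub>v (dim_row N))"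
  using assms(2)
proof (induction Ns)
  case Nil
  show ?case using x by (auto simp: stack_mats_def)
next
  case (Cons N Ns)
  let ?T = "stack_mats nc Ns"
  define nr where "nr = (\<Sum>N\<leftarrow>Ns. dim_row N)"
  have T: "?T \<in> carrier_mat nr nc"
    unfolding nr_def by (rule stack_mats_carrier) (use Cons.prems in auto)
  have N: "N \<in> carrier_mat (dim_row N) nc" using Cons.prems[of N] by auto
  have eq: "stack_mats nc (N # Ns) = N @\<^sub>r ?T" by (simp add: stack_mats_def)
  have dim: "dim_row (N @\<^sub>r ?T) = dim_row N + nr"
    using carrier_append_rows[OF N T] by auto
  have "0\<^sub>v (dim_row N + nr) = 0\<^sub>v (dim_row N) @\<^sub>v (0\<^sub>v nr :: 'a vec)"
    by (intro eq_vecI) auto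
  then have "(N @\<^sub>r ?T) *\<^sub>v x = 0\<^sub>v (dim_row (N @\<^sub>r ?T)) \<longleftrightarrow>
      N *\<^sub>v x = 0\<^sub>v (dim_row N) \<and> ?T *\<^sub>v x = 0\<^sub>v nr"
    unfolding mat_mult_append[OF N T x] dim
    using append_vec_eq[of "N *\<^sub>v x" "dim_row N" "0\<^sub>v (dim_row N)"]
    by (metis carrier_vecI dim_mult_mat_vec zero_carrier_vec)
  then show ?case using Cons T unfolding eq by auto
qed

text \<open>
  Derivation and evaluation are linear over the constants, so they commute with the multiplication by
  a constant vector.
\<close>

lemma poly_higher_pderiv_mult_const_vec:
  fixes G :: "'a::field poly mat"
  assumes "x \<in> carrier_vec (dim_col G)" "i < dim_row G"
  shows "(map_mat (\<lambda>p. poly p a) (deriv_mat l G) *\<^sub>v x) $ i =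
    poly ((pderiv ^^ l) ((G *\<^sub>v map_vec (\<lambda>c. [:c:]) x) $ i)) a"
proof -
  have "(pderiv ^^ l) (p * [:c:]) = (pderiv ^^ l) p * [:c:]" for p :: "'a poly" and c
    by (simp add: higher_pderiv_smult)
  then show ?thesis
    using assms by (simp add: deriv_mat_def scalar_prod_def higher_pderiv_sum poly_sum ac_simps)
qed

text \<open>
  The meaning of the stacked system: a constant vector lies in its kernel if and only if the
  polynomial vector \<open>G x\<close> is divisible by \<open>b\<close>, since the rows of the block for the \<open>j\<close>-th root are
  the Taylor conditions for divisibility by the \<open>j\<close>-th factor of \<open>b\<close>.
\<close>

lemma M_mat_mult_vec_eq_0_iff:
  fixes G :: "'a::field_char_0 poly mat"
  assumes x: "x \<in> carrier_vec (dim_col G)" and inj: "inj_on \<alpha> {1..r}"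
  shows "M_mat G r \<alpha> k *\<^sub>v x = 0\<^sub>v (dim_row (M_mat G r \<alpha> k)) \<longleftrightarrow>
    (\<forall>i<dim_row G. (\<Prod>j = 1..r. [:- \<alpha> j, 1:] ^ k j) dvd (G *\<^sub>v map_vec (\<lambda>c. [:c:]) x) $ i)"
proof -
  let ?E = "\<lambda>j l. map_mat (\<lambda>p. poly p (\<alpha> j)) (deriv_mat l G)"
  let ?p = "\<lambda>i. (G *\<^sub>v map_vec (\<lambda>c. [:c:]) x) $ i"
  have E: "?E j l *\<^sub>v x = 0\<^sub>v (dim_row (?E j l)) \<longleftrightarrow>
      (\<forall>i<dim_row G. poly ((pderiv ^^ l) (?p i)) (\<alpha> j) = 0)" for j l
    using poly_higher_pderiv_mult_const_vec[OF x, of _ "\<alpha> j" l]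
    by (auto simp: vec_eq_iff deriv_mat_def)
  have "N_mat G (\<alpha> j) (k j) *\<^sub>v x = 0\<^sub>v (dim_row (N_mat G (\<alpha> j) (k j))) \<longleftrightarrow>
      (\<forall>l<k j. ?E j l *\<^sub>v x = 0\<^sub>v (dim_row (?E j l)))" for j
    unfolding N_mat_def by (subst stack_mats_mult_vec_eq_0_iff[OF x]) (auto simp: deriv_mat_def)
  then have N: "N_mat G (\<alpha> j) (k j) *\<^sub>v x = 0\<^sub>v (dim_row (N_mat G (\<alpha> j) (k j))) \<longleftrightarrow>
      (\<forall>i<dim_row G. [:- \<alpha> j, 1:] ^ k j dvd ?p i)" for j
    unfolding E linear_power_dvd_iff_higher_pderiv by blast
  have "M_mat G r \<alpha> k *\<^sub>v x = 0\<^sub>v (dim_row (M_mat G r \<alpha> k)) \<longleftrightarrow>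
      (\<forall>j\<in>{1..r}. N_mat G (\<alpha> j) (k j) *\<^sub>v x = 0\<^sub>v (dim_row (N_mat G (\<alpha> j) (k j))))"
    unfolding M_mat_def by (subst stack_mats_mult_vec_eq_0_iff[OF x]) (auto simp: dim_col_N_mat)
  then show ?thesis
    unfolding N prod_linear_power_dvd_iff[OF finite_atLeastAtMost inj] by blast
qed

text \<open>
  For distinct columns a kernel vector is a linear dependency among them. Equal columns collapse in
  the set of columns, whose size then already bounds the rank below \<open>nc\<close>; the two cases are separate
  because linear independence is a notion for sets of vectors.
\<close>

lemma (in vec_space) nontrivial_kernel_rank_less:
  assumes A: "A \<in> carrier_mat n nc"
    and v: "v \<in> carrier_vec nc" "v \<noteq> 0\<^sub>v nc" "A *\<^sub>v v = 0\<^sub>v n"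
  shows "rank A < nc"
proof (cases "distinct (cols A)")
  case True
  then have "rank A \<noteq> nc"
    using lin_depI[OF A v] full_rank_lin_indpt[OF A] by blast
  then show ?thesis using rank_le_nc[OF A] by simp
next
  case False
  obtain S where S: "maximal S (\<lambda>T. T \<subseteq> set (cols A) \<and> lin_indpt T)"
    using maximal_exists[of "(\<lambda>T. T \<subseteq> set (cols A) \<and> lin_indpt T)" "card (set (cols A))" "{}"]
    by (meson List.finite_set card_mono empty_iff empty_subsetI finite_lin_indpt2 rev_finite_subset)
  then have "card S \<le> card (set (cols A))" by (simp add: card_mono maximal_def)
  also have "\<dots> < length (cols A)"
    using False card_length card_distinct by (metis le_neq_implies_less)
  finally show ?thesis using rank_card_indpt[OF A S] A by simp
qed

section \<open>Vectorisation\<close>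

lemma rowwise_index_less:
  fixes i j n :: nat
  assumes "i < n" "j < n"
  shows "i * n + j < n * n"
proof -
  have "i * n + j < Suc i * n" using assms by simp
  also have "\<dots> \<le> n * n" using assms by (intro mult_le_mono1) simp
  finally show ?thesis .
qed

text \<open>
  The vectorisation identity for the row-by-row enumeration: the equation \<open>(X \<otimes> Y\<^sup>T) vec V = vec (X V Y)\<close>
  makes a two-sided matrix product linear in the entries of the middle factor.
\<close>

lemma kronecker_mat_mult_vec:
  fixes X Y :: "'a::comm_semiring_1 mat"
  assumes X: "X \<in> carrier_mat n n" and Y: "Y \<in> carrier_mat n n"
    and x: "x \<in> carrier_vec (n * n)" and ij: "i < n" "j < n"
  shows "(kronecker_mat X (transpose_mat Y) *\<^sub>v x) $ (i * n + j) =
    (X * mat_of_rowwise_vec n x * Y) $$ (i, j)"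
proof -
  let ?V = "mat_of_rowwise_vec n x"
  have shift: "sum f {a * n..<a * n + n} = (\<Sum>b<n. f (b + a * n))" for f :: "nat \<Rightarrow> 'a" and a
    using sum.shift_bounds_nat_ivl[of f 0 "a * n" n] by (simp add: lessThan_atLeast0 add.commute)
  have "(kronecker_mat X (transpose_mat Y) *\<^sub>v x) $ (i * n + j) =
      (\<Sum>t<n * n. X $$ (i, t div n) * Y $$ (t mod n, j) * x $ t)"
    using X Y x ij rowwise_index_less[OF ij]
    by (auto simp: kronecker_mat_def scalar_prod_def lessThan_atLeast0 less_mult_imp_div_less
        intro!: sum.cong)
  also have "\<dots> = (\<Sum>a<n. \<Sum>t\<in>{a * n..<a * n + n}. X $$ (i, t div n) * Y $$ (t mod n, j) * x $ t)"
    by (rule sum.nat_group[symmetric])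
  also have "\<dots> = (\<Sum>a<n. \<Sum>b<n. X $$ (i, a) * ?V $$ (a, b) * Y $$ (b, j))"
  proof (rule sum.cong[OF refl])
    fix a assume a: "a \<in> {..<n}"
    have "(\<Sum>t\<in>{a * n..<a * n + n}. X $$ (i, t div n) * Y $$ (t mod n, j) * x $ t) =
        (\<Sum>b<n. X $$ (i, (b + a * n) div n) * Y $$ ((b + a * n) mod n, j) * x $ (b + a * n))"
      by (rule shift)
    also have "\<dots> = (\<Sum>b<n. X $$ (i, a) * ?V $$ (a, b) * Y $$ (b, j))"
      using a by (intro sum.cong) (auto simp: mat_of_rowwise_vec_def ac_simps)
    finally show "(\<Sum>t\<in>{a * n..<a * n + n}. X $$ (i, t div n) * Y $$ (t mod n, j) * x $ t) =
        (\<Sum>b<n. X $$ (i, a) * ?V $$ (a, b) * Y $$ (b, j))" .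
  qed
  also have "\<dots> = (\<Sum>b<n. (\<Sum>a<n. X $$ (i, a) * ?V $$ (a, b)) * Y $$ (b, j))"
    by (subst sum.swap) (simp add: sum_distrib_right)
  also have "\<dots> = (X * ?V * Y) $$ (i, j)"
    using X Y ij by (simp add: scalar_prod_def mat_of_rowwise_vec_def lessThan_atLeast0)
  finally show ?thesis .
qed

section \<open>The reduced adjugate\<close>

lemma smult_mat_cancel:
  fixes X Y :: "'a::idom mat"
  assumes "c \<cdot>\<^sub>m X = c \<cdot>\<^sub>m Y" "c \<noteq> 0"
  shows "X = Y"
proof (rule eq_matI)
  show d: "dim_row X = dim_row Y" "dim_col X = dim_col Y"
    using arg_cong[OF assms(1), of dim_row] arg_cong[OF assms(1), of dim_col] by auto
  fix i j assume "i < dim_row Y" "j < dim_col Y"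
  then show "X $$ (i, j) = Y $$ (i, j)"
    using arg_cong[OF assms(1), of "\<lambda>Z. Z $$ (i, j)"] d assms(2) by simp
qed

text \<open>
  Multiplying by the adjugate reduces the cancellation of \<open>B\<close> to that of the nonzero scalar \<open>det B\<close>,
  which avoids passing to the field of fractions.
\<close>

lemma mult_mat_cancel_left:
  fixes B X Y :: "'a::idom mat"
  assumes B: "B \<in> carrier_mat n n" "det B \<noteq> 0"
    and X: "X \<in> carrier_mat n m" and Y: "Y \<in> carrier_mat n m" and eq: "B * X = B * Y"
  shows "X = Y"
proof -
  note adj = adj_mat[OF B(1)]
  have *: "adj_mat B * (B * Z) = det B \<cdot>\<^sub>m Z" if Z: "Z \<in> carrier_mat n m" for Z
    using assoc_mult_mat[OF adj(1) B(1) Z] mult_smult_assoc_mat[OF one_carrier_mat Z] adj(3) Z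
    by simp
  show ?thesis using *[OF X] *[OF Y] eq B(2) smult_mat_cancel by metis
qed

lemma smith_normal_form_dvd_last:
  assumes "smith_normal_form n B s" "i \<in> {1..n}"
  shows "s i dvd s n"
proof -
  have "i \<le> m \<Longrightarrow> m \<le> n \<Longrightarrow> s i dvd s m" for m
  proof (induction m rule: dec_induct)
    case (step m)
    then have "s m dvd s (Suc m)" using assms unfolding smith_normal_form_def by auto
    then show ?case using step by (meson Suc_leD dvd_trans)
  qed simp
  then show ?thesis using assms by simp
qed

lemma det_smith_normal_form:
  fixes B :: "'a::field poly mat"
  assumes "smith_normal_form n B s"
  obtains c where "c dvd 1" "det B = c * (\<Prod>i = 1..n. s i)"
proof -
  let ?S = "mat_diag n (\<lambda>i. s (Suc i))"
  obtain P Q where PQ: "P \<in> GL_mat n" "Q \<in> GL_mat n" and B: "B = P * ?S * Q"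
    using assms unfolding smith_normal_form_def equivalent_mat_def by blast
  have P: "P \<in> carrier_mat n n" and Q: "Q \<in> carrier_mat n n" using PQ by (auto simp: GL_mat_def)
  have S: "?S \<in> carrier_mat n n" by simp
  have "det ?S = prod_list (diag_mat ?S)"
    by (rule det_upper_triangular[OF _ S]) (auto simp: mat_diag_def upper_triangular_def)
  also have "\<dots> = (\<Prod>i<n. s (Suc i))"
    unfolding prod_list_diag_prod by (auto simp: mat_diag_def lessThan_atLeast0 intro!: prod.cong)
  also have "\<dots> = (\<Prod>i = 1..n. s i)"
    using prod.atLeast_Suc_atMost_Suc_shift[of s 0 n]
    by (simp add: prod.atLeast1_atMost_eq)
  finally have "det B = (det P * det Q) * (\<Prod>i = 1..n. s i)"
    unfolding B using det_mult[OF _ Q, of "P * ?S"] det_mult[OF P S] P S by (simp add: ac_simps)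
  moreover have "det P * det Q dvd 1"
    using PQ GL_mat_iff_det_unit[OF P] GL_mat_iff_det_unit[OF Q]
    by (metis mult_1 mult_dvd_mono)
  ultimately show thesis using that by blast
qed

text \<open>
  The left Kronecker factor of \<open>D_mat\<close>.
\<close>

definition reduced_adj_mat :: "nat \<Rightarrow> (nat \<Rightarrow> 'a::field poly) \<Rightarrow> 'a poly mat \<Rightarrow> 'a poly mat" where
  "reduced_adj_mat n s B = map_mat (\<lambda>p. p div (\<Prod>i = 1..n - 1. s i)) (adj_mat B)"

text \<open>
  From \<open>B = P S Q\<close> and \<open>T = diag (s\<^sub>n / s\<^sub>i)\<close>, which is polynomial by the divisibility chain, the matrix
  \<open>E = Q\<inverse> T P\<inverse>\<close> satisfies \<open>B E = s\<^sub>n I\<close>. Up to the scalar \<open>c s\<^sub>1 \<dots> s\<^sub>n\<^sub>-\<^sub>1\<close>, with \<open>c\<close> the unit in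
  \<open>det B = c s\<^sub>1 \<dots> s\<^sub>n\<close>, it therefore solves the equation \<open>B X = det B I\<close> that determines the
  adjugate. This identifies \<open>c E\<close> with the reduced adjugate and shows along the way that the division
  in its definition is exact.
\<close>

lemma reduced_adj_mat_inverts:
  fixes B :: "'a::field poly mat"
  assumes n: "n \<ge> 1" and B: "B \<in> carrier_mat n n" and detB: "det B \<noteq> 0"
    and smith: "smith_normal_form n B s"
  obtains c where "c dvd 1"
    "B * reduced_adj_mat n s B = (c * s n) \<cdot>\<^sub>m 1\<^sub>m n"
    "reduced_adj_mat n s B * B = (c * s n) \<cdot>\<^sub>m 1\<^sub>m n"
proof -
  let ?d = "\<Prod>i = 1..n - 1. s i"
  let ?S = "mat_diag n (\<lambda>i. s (Suc i))"
  let ?T = "mat_diag n (\<lambda>i. s n div s (Suc i))"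
  obtain c where c: "c dvd 1" and det: "det B = c * (\<Prod>i = 1..n. s i)"
    by (rule det_smith_normal_form[OF smith])
  have "(\<Prod>i = 1..n. s i) = ?d * s n"
    using n prod.nat_ivl_Suc'[of 1 "n - 1" s] by (cases n) (auto simp: mult.commute)
  then have det': "det B = ?d * (c * s n)" using det by (simp add: ac_simps)
  then have d0: "?d \<noteq> 0" using detB by auto
  obtain P Q where PQ: "P \<in> GL_mat n" "Q \<in> GL_mat n" and BPQ: "B = P * ?S * Q"
    using smith unfolding smith_normal_form_def equivalent_mat_def by blast
  obtain P' where P': "P' \<in> GL_mat n" "P * P' = 1\<^sub>m n" using PQ(1) by (rule GL_mat_obtain_inverse)
  obtain Q' where Q': "Q' \<in> GL_mat n" "Q * Q' = 1\<^sub>m n" using PQ(2) by (rule GL_mat_obtain_inverse)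
  have car: "P \<in> carrier_mat n n" "Q \<in> carrier_mat n n" "P' \<in> carrier_mat n n" "Q' \<in> carrier_mat n n"
    using PQ P' Q' by (auto simp: GL_mat_def)
  have ST: "?S \<in> carrier_mat n n" "?T \<in> carrier_mat n n" by auto
  have "s (Suc i) * (s n div s (Suc i)) = s n" if "i < n" for i
    using smith_normal_form_dvd_last[OF smith, of "Suc i"] that by simp
  then have ST1: "?S * ?T = s n \<cdot>\<^sub>m 1\<^sub>m n"
    unfolding mat_diag_diag by (intro eq_matI) (auto simp: mat_diag_def)
  let ?E = "Q' * (?T * P')"
  have assoc: "X * Y * Z = X * (Y * Z)"
    if "X \<in> carrier_mat n n" "Y \<in> carrier_mat n n" "Z \<in> carrier_mat n n" for X Y Z :: "'a poly mat"
    using that by (rule assoc_mult_mat)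
  have closed: "X * Y \<in> carrier_mat n n"
    if "X \<in> carrier_mat n n" "Y \<in> carrier_mat n n" for X Y :: "'a poly mat"
    using that by (rule mult_carrier_mat)
  have E: "?E \<in> carrier_mat n n" using car by auto
  have "B * ?E = P * (?S * (Q * (Q' * (?T * P'))))"
    unfolding BPQ using car ST by (simp add: assoc closed del: mat_diag_diag)
  also have "\<dots> = P * (?S * ((Q * Q') * (?T * P')))"
    using car ST by (simp add: assoc closed del: mat_diag_diag)
  also have "\<dots> = P * ((?S * ?T) * P')"
    using car ST Q'(2)
    by (simp add: assoc closed left_mult_one_mat[of _ n n] del: mat_diag_diag)
  also have "\<dots> = s n \<cdot>\<^sub>m 1\<^sub>m n"
    unfolding ST1 using car P'(2) mult_smult_assoc_mat[of "1\<^sub>m n" n n P' n "s n"]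
      mult_smult_distrib[of P n n P' n "s n"] by simp
  finally have BE: "B * ?E = s n \<cdot>\<^sub>m 1\<^sub>m n" .
  let ?C = "c \<cdot>\<^sub>m ?E"
  have C: "?C \<in> carrier_mat n n" using E by simp
  have BC: "B * ?C = (c * s n) \<cdot>\<^sub>m 1\<^sub>m n"
    unfolding mult_smult_distrib[OF B E] BE by (intro eq_matI) auto
  \<comment> \<open>both sides equal \<open>det B\<close> times the identity, and \<open>B\<close> can be cancelled\<close>
  have "B * (?d \<cdot>\<^sub>m ?C) = B * adj_mat B"
    unfolding mult_smult_distrib[OF B C] BC adj_mat(2)[OF B] det' by (intro eq_matI) auto
  then have adj: "adj_mat B = ?d \<cdot>\<^sub>m ?C"
    using mult_mat_cancel_left[OF B detB _ adj_mat(1)[OF B], of "?d \<cdot>\<^sub>m ?C"] C by simp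
  have red: "reduced_adj_mat n s B = ?C"
    unfolding reduced_adj_mat_def adj using d0 by (intro eq_matI) auto
  have "?d \<cdot>\<^sub>m (?C * B) = adj_mat B * B"
    unfolding adj by (rule mult_smult_assoc_mat[OF C B, symmetric])
  also have "\<dots> = ?d \<cdot>\<^sub>m ((c * s n) \<cdot>\<^sub>m 1\<^sub>m n)"
    unfolding adj_mat(3)[OF B] det' by (intro eq_matI) auto
  finally have "?d \<cdot>\<^sub>m (?C * B) = ?d \<cdot>\<^sub>m ((c * s n) \<cdot>\<^sub>m 1\<^sub>m n)" .
  then have CB: "?C * B = (c * s n) \<cdot>\<^sub>m 1\<^sub>m n" using d0 by (rule smult_mat_cancel)
  show thesis using that[OF c] BC CB unfolding red by blast
qed

text \<open>
  Up to a unit, the reduced adjugate is \<open>s\<^sub>n B\<inverse>\<close>. So \<open>B\<inverse> X\<close> is a polynomial matrix exactly when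
  the product of the reduced adjugate with \<open>X\<close> is divisible by \<open>s\<^sub>n\<close>.
\<close>

lemma reduced_adj_mat_mult_dvd_iff:
  fixes B X :: "'a::field poly mat"
  assumes n: "n \<ge> 1" and B: "B \<in> carrier_mat n n" and detB: "det B \<noteq> 0"
    and smith: "smith_normal_form n B s" and X: "X \<in> carrier_mat n n"
  shows "(\<forall>i<n. \<forall>j<n. s n dvd (reduced_adj_mat n s B * X) $$ (i, j)) \<longleftrightarrow>
    (\<exists>Q\<in>carrier_mat n n. X = B * Q)"
proof -
  let ?C = "reduced_adj_mat n s B"
  have C: "?C \<in> carrier_mat n n" using adj_mat(1)[OF B] by (simp add: reduced_adj_mat_def)
  obtain c where c: "c dvd 1" and BC: "B * ?C = (c * s n) \<cdot>\<^sub>m 1\<^sub>m n"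
    and CB: "?C * B = (c * s n) \<cdot>\<^sub>m 1\<^sub>m n"
    by (rule reduced_adj_mat_inverts[OF n B detB smith])
  obtain c' where c': "1 = c * c'" using c by (rule dvdE)
  have "lead_coeff (s n) = 1" using smith n by (simp add: smith_normal_form_def)
  then have sn: "s n \<noteq> 0" by auto
  show ?thesis
  proof
    assume dvd: "\<forall>i<n. \<forall>j<n. s n dvd (?C * X) $$ (i, j)"
    define Y where "Y = map_mat (\<lambda>p. p div s n) (?C * X)"
    have Y: "Y \<in> carrier_mat n n" using C X by (simp add: Y_def)
    have CX: "?C * X = s n \<cdot>\<^sub>m Y"
      unfolding Y_def using dvd C X by (intro eq_matI) auto
    \<comment> \<open>compute \<open>B C X\<close> in two ways; the factor \<open>s n\<close> cancels and \<open>c\<close> is inverted by \<open>c'\<close>\<close>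
    have "s n \<cdot>\<^sub>m (c \<cdot>\<^sub>m X) = (c * s n) \<cdot>\<^sub>m X"
      by (intro eq_matI) (auto simp: ac_simps)
    also have "\<dots> = B * (?C * X)"
      using assoc_mult_mat[OF B C X] mult_smult_assoc_mat[OF one_carrier_mat X, of "c * s n"] X
      unfolding BC by simp
    also have "\<dots> = s n \<cdot>\<^sub>m (B * Y)" unfolding CX by (rule mult_smult_distrib[OF B Y])
    finally have cX: "c \<cdot>\<^sub>m X = B * Y" using sn by (rule smult_mat_cancel)
    have "X = c' \<cdot>\<^sub>m (c \<cdot>\<^sub>m X)"
      using c' by (intro eq_matI) (auto simp: mult.assoc[symmetric] mult.commute)
    also have "\<dots> = B * (c' \<cdot>\<^sub>m Y)" unfolding cX using mult_smult_distrib[OF B Y] by simp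
    finally show "\<exists>Q\<in>carrier_mat n n. X = B * Q" using Y by (intro bexI[of _ "c' \<cdot>\<^sub>m Y"]) auto
  next
    assume "\<exists>Q\<in>carrier_mat n n. X = B * Q"
    then obtain Q where Q: "Q \<in> carrier_mat n n" and XQ: "X = B * Q" by blast
    have "?C * X = (c * s n) \<cdot>\<^sub>m Q"
      unfolding XQ using assoc_mult_mat[OF C B Q] mult_smult_assoc_mat[OF one_carrier_mat Q] Q CB
      by simp
    then show "\<forall>i<n. \<forall>j<n. s n dvd (?C * X) $$ (i, j)" using Q by auto
  qed
qed

text \<open>
  Taking determinants in \<open>V A = B Q\<close> and cancelling the common product \<open>s\<^sub>1 \<dots> s\<^sub>n\<close> leaves \<open>det Q\<close> as
  a divisor of a unit.
\<close>

lemma quotient_in_GL_mat: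
  fixes A B :: "'a::field poly mat"
  assumes A: "A \<in> carrier_mat n n" and B: "B \<in> carrier_mat n n" and detB: "det B \<noteq> 0"
    and smithA: "smith_normal_form n A s" and smithB: "smith_normal_form n B s"
    and V: "V \<in> carrier_mat n n" "det V \<noteq> 0"
    and Q: "Q \<in> carrier_mat n n" and eq: "const_poly_mat V * A = B * Q"
  shows "Q \<in> GL_mat n"
proof -
  let ?\<Pi> = "\<Prod>i = 1..n. s i"
  obtain a where a: "a dvd 1" "det A = a * ?\<Pi>" by (rule det_smith_normal_form[OF smithA])
  obtain b where b: "b dvd 1" "det B = b * ?\<Pi>" by (rule det_smith_normal_form[OF smithB])
  have "?\<Pi> \<noteq> 0" using b detB by auto
  have "[:det V:] * det A = det B * det Q"
    using arg_cong[OF eq, of det] det_mult[OF _ A, of "const_poly_mat V"] det_mult[OF B Q] V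
    by (simp add: coeff_lift_hom.hom_det)
  then have "?\<Pi> * ([:det V:] * a) = ?\<Pi> * (b * det Q)" unfolding a b by (simp only: ac_simps)
  then have "[:det V:] * a = b * det Q"
    by (rule mult_left_cancel[OF \<open>?\<Pi> \<noteq> 0\<close>, THEN iffD1])
  then have "det Q dvd [:det V:] * a" by simp
  moreover have "[:det V:] * a dvd 1"
    using a(1) V(2) by (metis is_unit_mult_iff is_unit_pCons_iff)
  ultimately show ?thesis using GL_mat_iff_det_unit[OF Q] dvd_trans by blast
qed

section \<open>The criterion\<close>

text \<open>
  The kernel of the system consists of exactly those constant matrices \<open>V\<close>, singular ones included,
  for which \<open>V A\<close> is divisible by \<open>B\<close> on the left.
\<close>

lemma M_mat_D_mat_kernel_iff:
  fixes A B :: "'a::field_char_0 poly mat"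
  assumes n: "n \<ge> 1" and A: "A \<in> carrier_mat n n" and B: "B \<in> carrier_mat n n" "det B \<noteq> 0"
    and smith: "smith_normal_form n B s"
    and sn: "s n = (\<Prod>i = 1..r. [:- \<alpha> i, 1:] ^ k i)" and inj: "inj_on \<alpha> {1..r}"
    and x: "x \<in> carrier_vec (n * n)"
  defines "M \<equiv> M_mat (D_mat n s A B) r \<alpha> k"
  shows "M *\<^sub>v x = 0\<^sub>v (dim_row M) \<longleftrightarrow>
    (\<exists>Q\<in>carrier_mat n n. const_poly_mat (mat_of_rowwise_vec n x) * A = B * Q)"
proof -
  let ?C = "reduced_adj_mat n s B"
  let ?D = "kronecker_mat ?C (transpose_mat A)"
  let ?V = "const_poly_mat (mat_of_rowwise_vec n x)"
  let ?x = "map_vec (\<lambda>c. [:c:]) x"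
  have D: "D_mat n s A B = ?D" by (simp add: D_mat_def reduced_adj_mat_def)
  have C: "?C \<in> carrier_mat n n" using adj_mat(1)[OF B(1)] by (simp add: reduced_adj_mat_def)
  have dimD: "dim_row ?D = n * n" "dim_col ?D = n * n" using A C by (auto simp: kronecker_mat_def)
  have V: "mat_of_rowwise_vec n ?x = ?V"
    using x rowwise_index_less by (intro eq_matI) (auto simp: mat_of_rowwise_vec_def)
  have Vc: "?V \<in> carrier_mat n n" by (simp add: mat_of_rowwise_vec_def)
  have entry: "(?D *\<^sub>v ?x) $ (i * n + j) = (?C * (?V * A)) $$ (i, j)" if "i < n" "j < n" for i j
    using kronecker_mat_mult_vec[OF C A _ that, of ?x] x V assoc_mult_mat[OF C Vc A] by simp
  have "M *\<^sub>v x = 0\<^sub>v (dim_row M) \<longleftrightarrow> (\<forall>t<n * n. s n dvd (?D *\<^sub>v ?x) $ t)"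
    using M_mat_mult_vec_eq_0_iff[of x ?D \<alpha> r k] x inj dimD unfolding M_def D sn by simp
  also have "\<dots> \<longleftrightarrow> (\<forall>i<n. \<forall>j<n. s n dvd (?C * (?V * A)) $$ (i, j))"
  proof (intro iffI allI impI)
    fix i j assume "\<forall>t<n * n. s n dvd (?D *\<^sub>v ?x) $ t" "i < n" "j < n"
    then show "s n dvd (?C * (?V * A)) $$ (i, j)" using rowwise_index_less entry by metis
  next
    fix t assume *: "\<forall>i<n. \<forall>j<n. s n dvd (?C * (?V * A)) $$ (i, j)" and t: "t < n * n"
    have "t div n < n" "t mod n < n" using t n by (auto simp: less_mult_imp_div_less)
    then have "s n dvd (?D *\<^sub>v ?x) $ (t div n * n + t mod n)" using * entry by metis
    then show "s n dvd (?D *\<^sub>v ?x) $ t" by simp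
  qed
  also have "\<dots> \<longleftrightarrow> (\<exists>Q\<in>carrier_mat n n. ?V * A = B * Q)"
    using reduced_adj_mat_mult_dvd_iff[OF n B smith, of "?V * A"] Vc A by simp
  finally show ?thesis .
qed

text \<open>
  Moving the constant factor to the side of \<open>A\<close> makes the condition linear in the unknown constant
  matrix, which would otherwise occur in the product \<open>P B Q\<close> with the unknown \<open>Q\<close>.
\<close>

lemma semi_scalar_equivalent_iff_left_constant:
  fixes A B :: "'a::field poly mat"
  assumes A: "A \<in> carrier_mat n n" and B: "B \<in> carrier_mat n n"
  shows "semi_scalar_equivalent_mat n A B \<longleftrightarrow>
    (\<exists>V\<in>GL_mat n. \<exists>Q\<in>GL_mat n. const_poly_mat V * A = B * Q)"
proof -
  have move: "const_poly_mat P * Y = X"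
    if P: "P \<in> GL_mat n" "P' \<in> GL_mat n" "P * P' = 1\<^sub>m n" and X: "X \<in> carrier_mat n n"
      and eq: "Y = const_poly_mat P' * X" for P P' :: "'a mat" and X Y
  proof -
    have c: "P \<in> carrier_mat n n" "P' \<in> carrier_mat n n" using P by (auto simp: GL_mat_def)
    have "const_poly_mat P * const_poly_mat P' = 1\<^sub>m n"
      unfolding coeff_lift_hom.mat_hom_mult[OF c, symmetric] P(3) by (rule coeff_lift_hom.mat_hom_one)
    then show ?thesis unfolding eq using c X
      assoc_mult_mat[of "const_poly_mat P" n n "const_poly_mat P'" n X n] by simp
  qed
  show ?thesis
  proof
    assume "semi_scalar_equivalent_mat n A B"
    then obtain P Q where P: "P \<in> GL_mat n" and Q: "Q \<in> GL_mat n" and "A = const_poly_mat P * B * Q"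
      unfolding semi_scalar_equivalent_mat_def by blast
    moreover have "const_poly_mat P \<in> carrier_mat n n" "Q \<in> carrier_mat n n"
      using P Q by (auto simp: GL_mat_def)
    ultimately have eq: "A = const_poly_mat P * (B * Q)" "B * Q \<in> carrier_mat n n" using B by auto
    obtain V where V: "V \<in> GL_mat n" "V * P = 1\<^sub>m n" using P by (rule GL_mat_obtain_inverse)
    then show "\<exists>V\<in>GL_mat n. \<exists>Q\<in>GL_mat n. const_poly_mat V * A = B * Q"
      using move[OF V(1) P V(2) eq(2) eq(1)] Q by blast
  next
    assume "\<exists>V\<in>GL_mat n. \<exists>Q\<in>GL_mat n. const_poly_mat V * A = B * Q"
    then obtain V Q where V: "V \<in> GL_mat n" and Q: "Q \<in> GL_mat n"
      and eq: "const_poly_mat V * A = B * Q" by blast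
    obtain P where P: "P \<in> GL_mat n" "P * V = 1\<^sub>m n" using V by (rule GL_mat_obtain_inverse)
    have "const_poly_mat P \<in> carrier_mat n n" "Q \<in> carrier_mat n n"
      using P Q by (auto simp: GL_mat_def)
    then have "A = const_poly_mat P * B * Q"
      using move[OF P(1) V P(2) A eq[symmetric]] B by simp
    then show "semi_scalar_equivalent_mat n A B"
      using P Q unfolding semi_scalar_equivalent_mat_def by blast
  qed
qed

theorem theorem3p1:
  fixes n r :: nat
    and A B D :: "'a::field_char_0 poly mat"
    and M :: "'a mat"
    and s :: "nat \<Rightarrow> 'a poly"
    and \<alpha> :: "nat \<Rightarrow> 'a"
    and k :: "nat \<Rightarrow> nat"
  assumes "n \<ge> 1"
    and "A \<in> carrier_mat n n" and "B \<in> carrier_mat n n"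
    and "det A \<noteq> 0" and "det B \<noteq> 0"
    and "equivalent_mat n A B"
    and "smith_normal_form n A s" and "smith_normal_form n B s"
    and "s n = (\<Prod>i = 1..r. [:- \<alpha> i, 1:] ^ k i)"
    and "inj_on \<alpha> {1..r}"
    and "\<And>i. i \<in> {1..r} \<Longrightarrow> k i > 0"
    and "D = D_mat n s A B"
    and "M = M_mat D r \<alpha> k"
  shows "(semi_scalar_equivalent_mat n A B \<longleftrightarrow>
           rank_mat M < n\<^sup>2 \<and>
           (\<exists>x \<in> carrier_vec (n\<^sup>2). M *\<^sub>v x = 0\<^sub>v (dim_row M) \<and> det (mat_of_rowwise_vec n x) \<noteq> 0))
       \<and> (\<forall>x \<in> carrier_vec (n\<^sup>2).
           M *\<^sub>v x = 0\<^sub>v (dim_row M) \<and> det (mat_of_rowwise_vec n x) \<noteq> 0 \<longrightarrow>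
           (\<exists>Q \<in> GL_mat n. const_poly_mat (mat_of_rowwise_vec n x) * A = B * Q))"
proof -
  note A = assms(2) and B = assms(3,5) and n = assms(1)
  have nn: "n\<^sup>2 = n * n" by (simp add: power2_eq_square)
  have dimM: "dim_col M = n * n"
    using assms(12,13) A adj_mat(1)[OF B(1)] by (simp add: dim_col_M_mat D_mat_def kronecker_mat_def)
  have kernel: "M *\<^sub>v x = 0\<^sub>v (dim_row M) \<longleftrightarrow>
      (\<exists>Q\<in>carrier_mat n n. const_poly_mat (mat_of_rowwise_vec n x) * A = B * Q)"
    if "x \<in> carrier_vec (n * n)" for x
    unfolding assms(12,13) by (rule M_mat_D_mat_kernel_iff[OF n A B assms(8-10) that])
  have car: "mat_of_rowwise_vec n x \<in> carrier_mat n n" for x :: "'a vec"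
    by (simp add: mat_of_rowwise_vec_def)
  have quotient: "\<exists>Q\<in>GL_mat n. const_poly_mat (mat_of_rowwise_vec n x) * A = B * Q"
    if "x \<in> carrier_vec (n * n)" "M *\<^sub>v x = 0\<^sub>v (dim_row M)" "det (mat_of_rowwise_vec n x) \<noteq> 0" for x
    using kernel[OF that(1)] quotient_in_GL_mat[OF A B assms(7,8) car that(3)] that(2) by blast
  have rank: "rank_mat M < n * n"
    if x: "x \<in> carrier_vec (n * n)" "M *\<^sub>v x = 0\<^sub>v (dim_row M)" "det (mat_of_rowwise_vec n x) \<noteq> 0" for x
  proof -
    have "x \<noteq> 0\<^sub>v (n * n)"
    proof
      assume "x = 0\<^sub>v (n * n)"
      \<comment> \<open>a multiple by \<open>0\<close> has determinant \<open>0 ^ n * det V\<close>, which vanishes because \<open>n \<ge> 1\<close>\<close>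
      then have "mat_of_rowwise_vec n x = 0 \<cdot>\<^sub>m mat_of_rowwise_vec n x"
        using rowwise_index_less by (intro eq_matI) (auto simp: mat_of_rowwise_vec_def)
      then have "det (mat_of_rowwise_vec n x) = 0"
        using det_smult[of 0 "mat_of_rowwise_vec n x"] n car[of x] by (simp add: power_0_left)
      then show False using x(3) by simp
    qed
    moreover have "M \<in> carrier_mat (dim_row M) (n * n)" using dimM by auto
    ultimately show ?thesis
      unfolding rank_mat_def using x(1,2) by (intro vec_space.nontrivial_kernel_rank_less)
  qed
  have solution: "\<exists>x\<in>carrier_vec (n * n). M *\<^sub>v x = 0\<^sub>v (dim_row M) \<and> det (mat_of_rowwise_vec n x) \<noteq> 0"
    if V: "V \<in> GL_mat n" and Q: "Q \<in> GL_mat n" and eq: "const_poly_mat V * A = B * Q" for V Q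
  proof -
    define x where "x = vec (n * n) (\<lambda>t. V $$ (t div n, t mod n))"
    have Vc: "V \<in> carrier_mat n n" and Qc: "Q \<in> carrier_mat n n" using V Q by (auto simp: GL_mat_def)
    have xV: "mat_of_rowwise_vec n x = V"
      using Vc rowwise_index_less by (intro eq_matI) (auto simp: mat_of_rowwise_vec_def x_def)
    have xc: "x \<in> carrier_vec (n * n)" by (simp add: x_def)
    have "det V \<noteq> 0" using GL_mat_iff_det_unit[OF Vc] V by auto
    moreover have "M *\<^sub>v x = 0\<^sub>v (dim_row M)"
      unfolding kernel[OF xc] xV using eq Qc by (rule bexI)
    ultimately show ?thesis using xc xV by (intro bexI[of _ x]) simp_all
  qed
  have "semi_scalar_equivalent_mat n A B \<longleftrightarrow>
      (\<exists>x\<in>carrier_vec (n * n). M *\<^sub>v x = 0\<^sub>v (dim_row M) \<and> det (mat_of_rowwise_vec n x) \<noteq> 0)"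
    unfolding semi_scalar_equivalent_iff_left_constant[OF A B(1)]
  proof
    assume "\<exists>V\<in>GL_mat n. \<exists>Q\<in>GL_mat n. const_poly_mat V * A = B * Q"
    then show "\<exists>x\<in>carrier_vec (n * n). M *\<^sub>v x = 0\<^sub>v (dim_row M) \<and> det (mat_of_rowwise_vec n x) \<noteq> 0"
      using solution by (elim bexE)
  next
    assume "\<exists>x\<in>carrier_vec (n * n). M *\<^sub>v x = 0\<^sub>v (dim_row M) \<and> det (mat_of_rowwise_vec n x) \<noteq> 0"
    then obtain x where x: "x \<in> carrier_vec (n * n)" "M *\<^sub>v x = 0\<^sub>v (dim_row M)"
      "det (mat_of_rowwise_vec n x) \<noteq> 0" by (elim bexE conjE)
    have "mat_of_rowwise_vec n x \<in> GL_mat n"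
      using GL_mat_iff_det_unit[OF car] x(3) by (simp add: dvd_field_iff)
    then show "\<exists>V\<in>GL_mat n. \<exists>Q\<in>GL_mat n. const_poly_mat V * A = B * Q"
      using quotient[OF x] by (rule bexI[rotated])
  qed
  moreover have "rank_mat M < n * n"
    if "\<exists>x\<in>carrier_vec (n * n). M *\<^sub>v x = 0\<^sub>v (dim_row M) \<and> det (mat_of_rowwise_vec n x) \<noteq> 0"
    using that rank by (elim bexE conjE)
  ultimately have "semi_scalar_equivalent_mat n A B \<longleftrightarrow> rank_mat M < n * n \<and>
      (\<exists>x\<in>carrier_vec (n * n). M *\<^sub>v x = 0\<^sub>v (dim_row M) \<and> det (mat_of_rowwise_vec n x) \<noteq> 0)"
    by (iprover)
  then show ?thesis
    unfolding nn
  proof (intro conjI ballI impI)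
    fix x :: "'a vec"
    assume "x \<in> carrier_vec (n * n)" "M *\<^sub>v x = 0\<^sub>v (dim_row M) \<and> det (mat_of_rowwise_vec n x) \<noteq> 0"
    then show "\<exists>Q\<in>GL_mat n. const_poly_mat (mat_of_rowwise_vec n x) * A = B * Q"
      by (elim conjE quotient)
  qed assumption
qed

end
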